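(* $\diamondsuit$ implies $\clubsuit_C^{<\omega}$.
   Context: $\Lambda$ is the set of (nonzero) limit ordinals in $\omega_1$; club means closed unbounded. A ladder system is a sequence $\mathscr{L}=\langle L_\alpha:\alpha\in\Lambda\rangle$ where each $L_\alpha$ is a strictly increasing $\omega$-sequence of ordinals with limit $\alpha$; set $L_\alpha=\varnothing$ if $\alpha\in\omega_1\setminus\Lambda$. Define by induction $T^0_\alpha(\mathscr{L})=\{\alpha\}$ and $T^{n+1}_\alpha(\mathscr{L})=T^n_\alpha(\mathscr{L})\cup\bigcup_{\beta\in T^n_\alpha(\mathscr{L})}L_\beta$. $\clubsuit_C^{<\omega}$: there is a ladder system $\mathscr{L}=\langle L_\alpha:\alpha\in\Lambda\rangle$ such that for each club $C\subset\omega_1$ and each $n\in\omega$ there is a stationary set of $\alpha$ such that $T^n_\alpha(\mathscr{L})\subset C$. $\diamondsuit$: there is a sequence $\langle A_\alpha:\alpha\in\omega_1\rangle$ such that for each $E\subset\omega_1$ there is a stationary set of $\alpha$ for which $A_\alpha\cap\alpha=E\cap\alpha$. *)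

theory Defs
  imports "HOL-Library.Countable_Set_Type"
begin

section \<open>The ordinal $\omega_1$\<close>

text \<open>The elements of \<open>omega1\<close> are the ordinals below $\omega_1$: the field of the
  cardinal successor of \<open>natLeq\<close>, well-ordered by it. The lemmas
  \<open>uncountable_omega1\<close> and \<open>countable_below_omega1\<close> say that the order type
  is $\omega_1$. An ordinal \<open>\<alpha>\<close>, regarded as the set of smaller ordinals, is \<open>{..<\<alpha>}\<close>.\<close>

typedef omega1 = "Field (cardSuc natLeq)"
proof -
  have "infinite (Field (cardSuc natLeq))"
    using cardSuc_finite[OF natLeq_Card_order] by (simp add: Field_natLeq)
  then show ?thesis
    by (metis finite.emptyI ex_in_conv)
qed

lemma Well_order_omega1: "Well_order (cardSuc natLeq)"
  using cardSuc_Card_order[OF natLeq_Card_order] by (rule Card_order_wo_rel[unfolded wo_rel_def])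

instantiation omega1 :: wellorder
begin

definition less_eq_omega1 :: "omega1 \<Rightarrow> omega1 \<Rightarrow> bool" where
  "\<alpha> \<le> \<beta> \<longleftrightarrow> (Rep_omega1 \<alpha>, Rep_omega1 \<beta>) \<in> cardSuc natLeq"

definition less_omega1 :: "omega1 \<Rightarrow> omega1 \<Rightarrow> bool" where
  "(\<alpha> :: omega1) < \<beta> \<longleftrightarrow> \<alpha> \<le> \<beta> \<and> \<alpha> \<noteq> \<beta>"

instance
proof
  have wo: "Well_order (cardSuc natLeq)"
    by (rule Well_order_omega1)
  then have lin: "Linear_order (cardSuc natLeq)" and wf: "wf (cardSuc natLeq - Id)"
    by (auto simp: well_order_on_def)
  then have re: "refl_on (Field (cardSuc natLeq)) (cardSuc natLeq)"
    and tr: "trans (cardSuc natLeq)" and an: "antisym (cardSuc natLeq)"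
    and tot: "total_on (Field (cardSuc natLeq)) (cardSuc natLeq)"
    by (auto simp: linear_order_on_def partial_order_on_def preorder_on_def)
  fix \<alpha> \<beta> \<gamma> :: omega1
  show refl: "\<alpha> \<le> \<alpha>"
    using re Rep_omega1 by (auto simp: less_eq_omega1_def refl_on_def)
  show "\<alpha> \<le> \<beta> \<Longrightarrow> \<beta> \<le> \<gamma> \<Longrightarrow> \<alpha> \<le> \<gamma>"
    using tr by (auto simp: less_eq_omega1_def elim: transE)
  show antisym: "\<alpha> \<le> \<beta> \<Longrightarrow> \<beta> \<le> \<alpha> \<Longrightarrow> \<alpha> = \<beta>"
    using an by (metis less_eq_omega1_def antisymD Rep_omega1_inject)
  show "\<alpha> \<le> \<beta> \<or> \<beta> \<le> \<alpha>"
    using tot refl Rep_omega1 by (metis less_eq_omega1_def total_on_def Rep_omega1_inject)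
  show "\<alpha> < \<beta> \<longleftrightarrow> \<alpha> \<le> \<beta> \<and> \<not> \<beta> \<le> \<alpha>"
    using refl antisym by (auto simp: less_omega1_def)
  fix P :: "omega1 \<Rightarrow> bool" and a :: omega1
  assume step: "\<And>x. (\<And>y. y < x \<Longrightarrow> P y) \<Longrightarrow> P x"
  have "wf (inv_image (cardSuc natLeq - Id) Rep_omega1)"
    using wf by simp
  then show "P a"
  proof (induction a rule: wf_induct_rule)
    case (less x)
    show ?case
      by (rule step, rule less.IH)
        (auto simp: less_omega1_def less_eq_omega1_def in_inv_image Rep_omega1_inject)
  qed
qed

end

lemma uncountable_omega1:
  includes cardinal_syntax
  shows "uncountable (UNIV :: omega1 set)"
proof
  assume "countable (UNIV :: omega1 set)"
  then have "countable (range Rep_omega1)"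
    by simp
  then have "countable (Field (cardSuc natLeq))"
    using type_definition.Rep_range[OF type_definition_omega1] by simp
  then have "|Field (cardSuc natLeq)| \<le>o natLeq"
    using countable_card_of_nat card_of_nat ordLeq_ordIso_trans by blast
  moreover have "|Field (cardSuc natLeq)| =o cardSuc natLeq"
    by (rule card_of_Field_ordIso[OF cardSuc_Card_order[OF natLeq_Card_order]])
  ultimately have "cardSuc natLeq \<le>o natLeq"
    using ordIso_ordLeq_trans ordIso_symmetric by blast
  then show False
    using cardSuc_greater[OF natLeq_Card_order] not_ordLess_ordLeq by blast
qed

lemma countable_below_omega1:
  includes cardinal_syntax
  shows "countable {..<\<alpha> :: omega1}"
proof -
  let ?S = "underS (cardSuc natLeq) (Rep_omega1 \<alpha>)"
  have "|?S| <o cardSuc natLeq"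
    using card_of_underS[OF cardSuc_Card_order[OF natLeq_Card_order] Rep_omega1] .
  then have "|?S| \<le>o natLeq"
    using cardSuc_ordLeq_ordLess[OF natLeq_Card_order card_of_Card_order] by blast
  then have "countable ?S"
    using countable_card_of_nat card_of_nat ordIso_symmetric ordLeq_ordIso_trans by blast
  moreover have "Rep_omega1 ` {..<\<alpha>} \<subseteq> ?S"
    by (auto simp: underS_def less_omega1_def less_eq_omega1_def Rep_omega1_inject)
  ultimately have "countable (Rep_omega1 ` {..<\<alpha>})"
    by (rule countable_subset[rotated])
  then show ?thesis
    by (rule countable_image_inj_on) (auto simp: inj_on_def Rep_omega1_inject)
qed


section \<open>Club and stationary subsets of $\omega_1$\<close>

definition Limits :: "omega1 set" where
  "Limits = {\<alpha>. (\<exists>\<beta>. \<beta> < \<alpha>) \<and> (\<forall>\<beta><\<alpha>. \<exists>\<gamma><\<alpha>. \<beta> < \<gamma>)}"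

definition unbounded_in :: "omega1 set \<Rightarrow> omega1 \<Rightarrow> bool" where
  "unbounded_in C \<alpha> \<longleftrightarrow> (\<forall>\<beta><\<alpha>. \<exists>\<gamma>\<in>C. \<beta> < \<gamma> \<and> \<gamma> < \<alpha>)"

definition club :: "omega1 set \<Rightarrow> bool" where
  "club C \<longleftrightarrow> (\<forall>\<alpha>. \<exists>\<beta>\<in>C. \<alpha> < \<beta>) \<and> (\<forall>\<alpha>\<in>Limits. unbounded_in C \<alpha> \<longrightarrow> \<alpha> \<in> C)"

definition stationary :: "omega1 set \<Rightarrow> bool" where
  "stationary S \<longleftrightarrow> (\<forall>C. club C \<longrightarrow> S \<inter> C \<noteq> {})"


section \<open>Ladder systems\<close>

text \<open>A sequence indexed by \<open>Limits\<close> is represented by a total function whose values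
  outside \<open>Limits\<close> are irrelevant; \<open>ladder\<close> is the set of terms of
  $L_\alpha$, and discards those values.\<close>

definition ladder_system :: "(omega1 \<Rightarrow> nat \<Rightarrow> omega1) \<Rightarrow> bool" where
  "ladder_system L \<longleftrightarrow>
    (\<forall>\<alpha>\<in>Limits. strict_mono (L \<alpha>) \<and> (\<forall>n. L \<alpha> n < \<alpha>) \<and> (\<forall>\<beta><\<alpha>. \<exists>n. \<beta> < L \<alpha> n))"

definition ladder :: "(omega1 \<Rightarrow> nat \<Rightarrow> omega1) \<Rightarrow> omega1 \<Rightarrow> omega1 set" where
  "ladder L \<alpha> = (if \<alpha> \<in> Limits then range (L \<alpha>) else {})"

primrec T :: "(omega1 \<Rightarrow> nat \<Rightarrow> omega1) \<Rightarrow> nat \<Rightarrow> omega1 \<Rightarrow> omega1 set" where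
  "T L 0 \<alpha> = {\<alpha>}"
| "T L (Suc n) \<alpha> = T L n \<alpha> \<union> (\<Union>\<beta>\<in>T L n \<alpha>. ladder L \<beta>)"


section \<open>The guessing principles\<close>

definition club_C_fin :: bool where
  "club_C_fin \<longleftrightarrow>
    (\<exists>L. ladder_system L \<and> (\<forall>C n. club C \<longrightarrow> stationary {\<alpha>. T L n \<alpha> \<subseteq> C}))"

definition diamond :: bool where
  "diamond \<longleftrightarrow>
    (\<exists>A :: omega1 \<Rightarrow> omega1 set. \<forall>E. stationary {\<alpha>. A \<alpha> \<inter> {..<\<alpha>} = E \<inter> {..<\<alpha>}})"

end

theory Submission
  imports Defs
begin

text \<open>
  Let \<open>A\<close> be a diamond sequence. It can be arranged to guess, besides a set \<open>E\<close>, a natural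
  number \<open>n\<close>, which is coded by the least element of the guessed set; \<open>E\<close> is then guessed only
  above some ordinal, which is enough for clubs (\<open>diamond_with_number\<close>).
  The ladders are then built by recursion on \<open>\<alpha>\<close> (\<open>guided_ladder_system\<close>): if \<open>\<alpha>\<close> guesses
  \<open>E\<close> and \<open>n\<close>, and the set of those \<open>\<beta>\<close> for which $T^n_\beta$ is contained in the guessed set
  is unbounded in \<open>\<alpha>\<close>, then the ladder at \<open>\<alpha>\<close> runs through this set. The set is known at stage
  \<open>\<alpha>\<close>, because $T^n_\beta$ depends only on ladders up to \<open>\<beta>\<close>.

  That the set of \<open>\<alpha>\<close> with $T^n_\alpha \subseteq C$ is stationary for all clubs \<open>C\<close> follows by
  induction on \<open>n\<close>. In the step, the set \<open>S\<close> of all \<open>\<beta>\<close> with $T^n_\beta \subseteq C$ is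
  stationary, hence unbounded, so its limit points form a club. At a limit point \<open>\<alpha>\<close> of \<open>S\<close>
  that lies in \<open>C\<close> and guesses \<open>C\<close> and \<open>n\<close> correctly, the ladder runs through \<open>S\<close>, and
  $T^{n+1}_\alpha = \{\alpha\} \cup \bigcup_{\beta \in L_\alpha} T^n_\beta$ is contained in \<open>C\<close>.

  The number is guessed for the following reason: when \<open>S\<close> is unbounded in \<open>\<alpha>\<close> for every \<open>n\<close>,
  a single ladder cannot in general run through all of these sets at once. Indeed, if \<open>C\<close>
  consists of limit ordinals, no \<open>\<beta>\<close> satisfies $T^n_\beta \subseteq C$ for all \<open>n\<close>, as the least
  element of $\bigcup_n T^n_\beta$ is not a limit.
\<close>

section \<open>Clubs and stationary sets\<close>

lemma countable_bounded_omega1: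
  fixes X :: "omega1 set"
  assumes "countable X"
  shows "\<exists>\<delta>. \<forall>x\<in>X. x < \<delta>"
proof -
  have "{..x} = insert x {..<x}" for x :: omega1
    by auto
  then have "countable (\<Union>x\<in>X. {..x})"
    using assms countable_below_omega1 by auto
  then obtain \<delta> where "\<delta> \<notin> (\<Union>x\<in>X. {..x})"
    using uncountable_omega1 by (metis UNIV_eq_I)
  then show ?thesis
    by (auto simp: not_le)
qed

text \<open>The supremum of an increasing \<open>\<omega>\<close>-sequence that alternates between \<open>X\<close> and \<open>Y\<close>
  is a limit point of both. Taking \<open>X = Y\<close> gives that limit points are cofinal; taking two
  clubs gives that their intersection is unbounded.\<close>

lemma common_limit_point:
  assumes X: "\<forall>\<alpha>. \<exists>\<beta>\<in>X. \<alpha> < \<beta>" and Y: "\<forall>\<alpha>. \<exists>\<beta>\<in>Y. \<alpha> < \<beta>"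
  shows "\<exists>\<delta>\<in>Limits. \<alpha> < \<delta> \<and> unbounded_in X \<delta> \<and> unbounded_in Y \<delta>"
proof -
  have "\<exists>l. \<forall>n. \<alpha> < l n \<and> (\<exists>x\<in>X. \<exists>y\<in>Y. l n < x \<and> x < y \<and> y < l (Suc n))"
  proof (rule dependent_nat_choice)
    show "\<exists>\<beta>. \<alpha> < \<beta>"
      using X by blast
    show "\<exists>\<gamma>. \<alpha> < \<gamma> \<and> (\<exists>x\<in>X. \<exists>y\<in>Y. \<beta> < x \<and> x < y \<and> y < \<gamma>)" if "\<alpha> < \<beta>" for \<beta> :: omega1
      using that X Y by (meson less_trans)
  qed
  then obtain l where l: "\<alpha> < l n" "\<exists>x\<in>X. \<exists>y\<in>Y. l n < x \<and> x < y \<and> y < l (Suc n)" for n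
    by blast
  define \<delta> where "\<delta> = (LEAST \<delta>. \<forall>n. l n < \<delta>)"
  have above: "l n < \<delta>" for n
    using countable_bounded_omega1[of "range l"] LeastI_ex[of "\<lambda>\<delta>. \<forall>n. l n < \<delta>"]
    unfolding \<delta>_def by auto
  have cofinal: "\<exists>n. \<beta> \<le> l n" if "\<beta> < \<delta>" for \<beta>
    using not_less_Least[OF that[unfolded \<delta>_def]] by (auto simp: not_less)
  have XY: "\<exists>x\<in>X. \<exists>y\<in>Y. \<beta> < x \<and> x < \<delta> \<and> \<beta> < y \<and> y < \<delta>" if \<beta>: "\<beta> < \<delta>" for \<beta>
  proof -
    obtain n where "\<beta> \<le> l n"
      using cofinal[OF \<beta>] by blast
    moreover obtain x y where "x \<in> X" "y \<in> Y" "l n < x" "x < y" "y < l (Suc n)"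
      using l(2) by blast
    ultimately show ?thesis
      using above[of "Suc n"] by (meson le_less_trans less_trans)
  qed
  have "\<alpha> < \<delta>"
    using l(1) above less_trans by blast
  moreover have "\<delta> \<in> Limits"
    using XY \<open>\<alpha> < \<delta>\<close> unfolding Limits_def by blast
  ultimately show ?thesis
    using XY unfolding unbounded_in_def by blast
qed

lemma unbounded_in_mono:
  assumes "unbounded_in X \<alpha>" "\<And>\<beta>. \<beta> \<in> X \<Longrightarrow> \<beta> < \<alpha> \<Longrightarrow> \<beta> \<in> Y"
  shows "unbounded_in Y \<alpha>"
  using assms unfolding unbounded_in_def by meson

lemma club_Int:
  assumes "club C" "club D"
  shows "club (C \<inter> D)"
  unfolding club_def
proof (intro conjI allI ballI impI)
  show "\<exists>\<beta>\<in>C \<inter> D. \<alpha> < \<beta>" for \<alpha>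
    using common_limit_point[of C D \<alpha>] assms unfolding club_def by blast
  show "\<alpha> \<in> C \<inter> D" if "\<alpha> \<in> Limits" "unbounded_in (C \<inter> D) \<alpha>" for \<alpha>
    using that assms unbounded_in_mono[OF that(2)] unfolding club_def by blast
qed

lemma club_limit_points:
  assumes "\<forall>\<alpha>. \<exists>\<beta>\<in>S. \<alpha> < \<beta>"
  shows "club {\<alpha>\<in>Limits. unbounded_in S \<alpha>}"
  unfolding club_def
proof (intro conjI allI ballI impI)
  show "\<exists>\<beta>\<in>{\<alpha>\<in>Limits. unbounded_in S \<alpha>}. \<alpha> < \<beta>" for \<alpha>
    using common_limit_point[OF assms assms, of \<alpha>] by blast
  show "\<alpha> \<in> {\<alpha>\<in>Limits. unbounded_in S \<alpha>}"
    if "\<alpha> \<in> Limits" "unbounded_in {\<alpha>\<in>Limits. unbounded_in S \<alpha>} \<alpha>" for \<alpha>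
    using that unfolding unbounded_in_def by (blast intro: less_trans)
qed

lemma club_greaterThan: "club {\<gamma><..}"
  unfolding club_def
proof (intro conjI allI ballI impI)
  show "\<exists>\<beta>\<in>{\<gamma><..}. \<alpha> < \<beta>" for \<alpha>
    using countable_bounded_omega1[of "{\<alpha>, \<gamma>}"] by auto
  show "\<alpha> \<in> {\<gamma><..}" if "\<alpha> \<in> Limits" "unbounded_in {\<gamma><..} \<alpha>" for \<alpha>
    using that unfolding Limits_def unbounded_in_def by (auto intro: less_trans)
qed

lemma club_stationary:
  assumes "club C"
  shows "stationary C"
  using club_Int[OF assms] unfolding stationary_def club_def by blast

lemma stationary_unbounded:
  assumes "stationary S"
  shows "\<forall>\<alpha>. \<exists>\<beta>\<in>S. \<alpha> < \<beta>"
  using assms club_greaterThan unfolding stationary_def by blast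


section \<open>The trees \<open>T\<close> of a ladder system\<close>

lemma root_in_T: "\<alpha> \<in> T L n \<alpha>"
  by (induction n) auto

text \<open>The definition extends the tree at its leaves; the induction in the final theorem splits
  it at its root instead.\<close>

lemma T_Suc_root: "T L (Suc n) \<alpha> = insert \<alpha> (\<Union>\<beta>\<in>ladder L \<alpha>. T L n \<beta>)"
proof (induction n)
  case 0
  show ?case by auto
next
  case (Suc n)
  have "T L (Suc (Suc n)) \<alpha> = T L (Suc n) \<alpha> \<union> (\<Union>\<beta>\<in>T L (Suc n) \<alpha>. ladder L \<beta>)"
    by simp
  also have "\<dots> = insert \<alpha> (ladder L \<alpha> \<union> (\<Union>\<beta>\<in>ladder L \<alpha>. T L (Suc n) \<beta>))"
    unfolding Suc.IH by auto
  also have "\<dots> = insert \<alpha> (\<Union>\<beta>\<in>ladder L \<alpha>. T L (Suc n) \<beta>)"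
    using root_in_T by blast
  finally show ?case .
qed

lemma T_le:
  assumes "ladder_system L" "\<beta> \<in> T L n \<alpha>"
  shows "\<beta> \<le> \<alpha>"
  using assms(2)
proof (induction n arbitrary: \<beta>)
  case (Suc n)
  have "\<gamma> < \<beta>" if "\<gamma> \<in> ladder L \<beta>" for \<beta> \<gamma>
    using that assms(1) unfolding ladder_def ladder_system_def by (auto split: if_splits)
  then show ?case
    using Suc by fastforce
qed simp

text \<open>This locality makes the trees below \<open>\<alpha>\<close> available in a recursive choice of the
  ladder at \<open>\<alpha>\<close>.\<close>

lemma T_cong:
  assumes "ladder_system L" "\<And>\<beta>. \<beta> \<le> \<alpha> \<Longrightarrow> M \<beta> = L \<beta>"
  shows "T M n \<alpha> = T L n \<alpha>"
proof (induction n)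
  case (Suc n)
  have "ladder M \<beta> = ladder L \<beta>" if "\<beta> \<in> T L n \<alpha>" for \<beta>
    using assms(2)[OF T_le[OF assms(1) that]] by (simp add: ladder_def)
  then show ?case
    using Suc by simp
qed simp


section \<open>Ladders through prescribed sets\<close>

definition is_ladder_through :: "omega1 set \<Rightarrow> omega1 \<Rightarrow> (nat \<Rightarrow> omega1) \<Rightarrow> bool" where
  "is_ladder_through S \<alpha> l \<longleftrightarrow>
    strict_mono l \<and> range l \<subseteq> S \<inter> {..<\<alpha>} \<and> (\<forall>\<beta><\<alpha>. \<exists>n. \<beta> < l n)"

lemma ladder_through_exists:
  assumes \<alpha>: "\<alpha> \<in> Limits" and S: "unbounded_in S \<alpha>"
  shows "\<exists>l. is_ladder_through S \<alpha> l"
proof -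
  have ne: "{..<\<alpha>} \<noteq> {}"
    using \<alpha> by (auto simp: Limits_def)
  define e where "e = from_nat_into {..<\<alpha>}"
  have e: "range e = {..<\<alpha>}"
    unfolding e_def by (rule range_from_nat_into[OF ne countable_below_omega1])
  \<comment> \<open>Cofinality is ensured by passing the \<open>n\<close>-th ordinal below \<open>\<alpha>\<close> at step \<open>n\<close>.\<close>
  have "\<exists>l. \<forall>n. (l n \<in> S \<and> l n < \<alpha>) \<and> (l n < l (Suc n) \<and> e n < l (Suc n))"
  proof (rule dependent_nat_choice)
    show "\<exists>x. x \<in> S \<and> x < \<alpha>"
      using ne S unfolding unbounded_in_def by blast
    fix x n
    assume "x \<in> S \<and> x < \<alpha>"
    moreover have "e n < \<alpha>"
      using e by blast
    ultimately have "max x (e n) < \<alpha>"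
      by simp
    then obtain y where "y \<in> S" "max x (e n) < y" "y < \<alpha>"
      using S unfolding unbounded_in_def by blast
    then show "\<exists>y. (y \<in> S \<and> y < \<alpha>) \<and> x < y \<and> e n < y"
      by auto
  qed
  then obtain l where l: "l n \<in> S" "l n < \<alpha>" "l n < l (Suc n)" "e n < l (Suc n)" for n
    by blast
  have "\<exists>n. \<beta> < l n" if "\<beta> < \<alpha>" for \<beta>
  proof -
    have "\<beta> \<in> range e"
      using that e by simp
    then obtain n where "\<beta> = e n"
      by blast
    then show ?thesis
      using l(4) by blast
  qed
  then show ?thesis
    using l unfolding is_ladder_through_def by (auto simp: strict_mono_Suc_iff)
qed

text \<open>The prediction that \<open>\<alpha>\<close> makes is the pair \<open>(A \<alpha>, N \<alpha>)\<close>; at limits where no ladder through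
  the desired set exists, an arbitrary ladder is used.\<close>

lemma guided_ladder_system:
  fixes A :: "omega1 \<Rightarrow> omega1 set" and N :: "omega1 \<Rightarrow> nat"
  shows "\<exists>L. ladder_system L \<and>
    (\<forall>\<alpha>\<in>Limits. unbounded_in {\<beta>. T L (N \<alpha>) \<beta> \<subseteq> A \<alpha>} \<alpha> \<longrightarrow>
      (\<forall>\<beta>\<in>ladder L \<alpha>. T L (N \<alpha>) \<beta> \<subseteq> A \<alpha>))"
proof -
  define target where "target M \<alpha> = {\<beta>. T M (N \<alpha>) \<beta> \<subseteq> A \<alpha>}" for M \<alpha>
  define aim where
    "aim M \<alpha> = (if unbounded_in (target M \<alpha>) \<alpha> then target M \<alpha> else UNIV)" for M \<alpha>
  define R where "R = {(\<beta>, \<alpha> :: omega1). \<beta> < \<alpha>}"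
  define L where "L = wfrec R (\<lambda>M \<alpha>. SOME l. is_ladder_through (aim M \<alpha>) \<alpha> l)"
  have "wf R"
    unfolding R_def by (rule wf)
  then have L_rec: "L \<alpha> = (SOME l. is_ladder_through (aim (cut L R \<alpha>) \<alpha>) \<alpha> l)" for \<alpha>
    unfolding L_def by (rule wfrec)
  have through: "is_ladder_through (aim (cut L R \<alpha>) \<alpha>) \<alpha> (L \<alpha>)" if "\<alpha> \<in> Limits" for \<alpha>
  proof -
    have "unbounded_in UNIV \<alpha>"
      using that by (auto simp: Limits_def unbounded_in_def)
    then have "unbounded_in (aim (cut L R \<alpha>) \<alpha>) \<alpha>"
      by (simp add: aim_def)
    then have "\<exists>l. is_ladder_through (aim (cut L R \<alpha>) \<alpha>) \<alpha> l"
      by (rule ladder_through_exists[OF that])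
    from someI_ex[OF this] show ?thesis
      by (simp only: L_rec[symmetric])
  qed
  then have L: "ladder_system L"
    unfolding ladder_system_def is_ladder_through_def by blast
  have target_cut: "\<beta> \<in> target (cut L R \<alpha>) \<alpha> \<longleftrightarrow> \<beta> \<in> target L \<alpha>" if "\<beta> < \<alpha>" for \<alpha> \<beta>
  proof -
    have "T (cut L R \<alpha>) (N \<alpha>) \<beta> = T L (N \<alpha>) \<beta>"
      by (rule T_cong[OF L]) (use that in \<open>auto simp: cut_def R_def\<close>)
    then show ?thesis
      by (simp add: target_def)
  qed
  have "\<beta> \<in> target L \<alpha>"
    if \<alpha>: "\<alpha> \<in> Limits" and unb: "unbounded_in (target L \<alpha>) \<alpha>" and \<beta>: "\<beta> \<in> ladder L \<alpha>" for \<alpha> \<beta>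
  proof -
    have "unbounded_in (target (cut L R \<alpha>) \<alpha>) \<alpha>"
      using unbounded_in_mono[OF unb] target_cut by blast
    then have "\<beta> \<in> target (cut L R \<alpha>) \<alpha>" "\<beta> < \<alpha>"
      using through[OF \<alpha>] \<alpha> \<beta> unfolding is_ladder_through_def ladder_def aim_def by auto
    then show ?thesis
      using target_cut by blast
  qed
  then show ?thesis
    using L unfolding target_def by blast
qed


section \<open>Guessing a set together with a number\<close>

text \<open>Fix distinct ordinals \<open>e n\<close>. The pair of \<open>E\<close> and \<open>n\<close> is coded by the part of \<open>E\<close> above
  \<open>e n\<close> with \<open>e n\<close> itself added: its least element determines \<open>n\<close>, and the remaining elements
  determine \<open>E\<close> above \<open>\<gamma> = e n\<close>. Losing the part of \<open>E\<close> up to \<open>\<gamma>\<close> is harmless when guessing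
  clubs, since a final segment of a club is a club.\<close>

lemma diamond_with_number:
  assumes diamond
  shows "\<exists>A N. \<forall>E (n::nat). \<exists>\<gamma>. stationary {\<alpha>. A \<alpha> = E \<inter> {\<gamma><..<\<alpha>} \<and> N \<alpha> = n}"
proof -
  obtain G :: "omega1 \<Rightarrow> omega1 set"
    where G: "stationary {\<alpha>. G \<alpha> \<inter> {..<\<alpha>} = E \<inter> {..<\<alpha>}}" for E
    using assms unfolding diamond_def by blast
  have "infinite (UNIV :: omega1 set)"
    using uncountable_omega1 uncountable_infinite by blast
  then obtain e :: "nat \<Rightarrow> omega1" where e: "inj e"
    using infinite_countable_subset by blast
  define \<mu> where "\<mu> \<alpha> = (LEAST \<xi>. \<xi> \<in> G \<alpha> \<inter> {..<\<alpha>})" for \<alpha>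
  define A where "A \<alpha> = G \<alpha> \<inter> {\<mu> \<alpha><..<\<alpha>}" for \<alpha>
  define N where "N \<alpha> = inv e (\<mu> \<alpha>)" for \<alpha>
  have "stationary {\<alpha>. A \<alpha> = E \<inter> {e n<..<\<alpha>} \<and> N \<alpha> = n}" for E n
    unfolding stationary_def
  proof (intro allI impI)
    fix D
    assume "club D"
    then have "club (D \<inter> {e n<..})"
      by (rule club_Int[OF _ club_greaterThan])
    then obtain \<alpha> where \<alpha>: "\<alpha> \<in> D" "e n < \<alpha>"
      and code: "G \<alpha> \<inter> {..<\<alpha>} = insert (e n) (E \<inter> {e n<..}) \<inter> {..<\<alpha>}"
      using G[of "insert (e n) (E \<inter> {e n<..})"] unfolding stationary_def by blast
    have \<mu>: "\<mu> \<alpha> = e n"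
      unfolding \<mu>_def code by (rule Least_equality) (use \<alpha> in auto)
    then have "N \<alpha> = n"
      using e by (simp add: N_def)
    moreover have "A \<alpha> = E \<inter> {e n<..<\<alpha>}"
    proof -
      have "A \<alpha> = (G \<alpha> \<inter> {..<\<alpha>}) \<inter> {e n<..}"
        unfolding A_def \<mu> by auto
      also have "\<dots> = E \<inter> {e n<..<\<alpha>}"
        unfolding code by auto
      finally show ?thesis .
    qed
    ultimately show "{\<alpha>. A \<alpha> = E \<inter> {e n<..<\<alpha>} \<and> N \<alpha> = n} \<inter> D \<noteq> {}"
      using \<alpha> by blast
  qed
  then show ?thesis
    by blast
qed


section \<open>From diamond to ladders in clubs\<close>

theorem lemma7p3:
  shows "diamond \<longrightarrow> club_C_fin"
proof
  assume diamond
  then obtain A and N :: "omega1 \<Rightarrow> nat"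
    where guess: "\<And>E n. \<exists>\<gamma>. stationary {\<alpha>. A \<alpha> = E \<inter> {\<gamma><..<\<alpha>} \<and> N \<alpha> = n}"
    using diamond_with_number by blast
  obtain L where L: "ladder_system L"
    and guided: "\<And>\<alpha> \<beta>. \<alpha> \<in> Limits \<Longrightarrow> unbounded_in {\<beta>. T L (N \<alpha>) \<beta> \<subseteq> A \<alpha>} \<alpha> \<Longrightarrow>
      \<beta> \<in> ladder L \<alpha> \<Longrightarrow> T L (N \<alpha>) \<beta> \<subseteq> A \<alpha>"
    using guided_ladder_system[of N A] by blast
  have "stationary {\<alpha>. T L n \<alpha> \<subseteq> C}" if "club C" for C n
    using that
  proof (induction n arbitrary: C)
    case 0
    then show ?case
      using club_stationary by simp
  next
    case (Suc n)
    obtain \<gamma> where \<gamma>: "stationary {\<alpha>. A \<alpha> = C \<inter> {\<gamma><..<\<alpha>} \<and> N \<alpha> = n}"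
      using guess by blast
    \<comment> \<open>The trees are kept above \<open>\<gamma>\<close>, since the guesses see only this part of \<open>C\<close>.\<close>
    define S where "S = {\<beta>. T L n \<beta> \<subseteq> C \<inter> {\<gamma><..}}"
    have "stationary S"
      unfolding S_def by (rule Suc.IH[OF club_Int[OF Suc.prems club_greaterThan]])
    then have club_S: "club {\<alpha>\<in>Limits. unbounded_in S \<alpha>}"
      by (rule club_limit_points[OF stationary_unbounded])
    show ?case
      unfolding stationary_def
    proof (intro allI impI)
      fix D
      assume "club D"
      then have "club (D \<inter> (C \<inter> {\<alpha>\<in>Limits. unbounded_in S \<alpha>}))"
        by (intro club_Int Suc.prems club_S)
      then obtain \<alpha> where \<alpha>: "\<alpha> \<in> D" "\<alpha> \<in> C" "\<alpha> \<in> Limits" "unbounded_in S \<alpha>"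
        "A \<alpha> = C \<inter> {\<gamma><..<\<alpha>}" "N \<alpha> = n"
        using \<gamma> unfolding stationary_def by blast
      have "unbounded_in {\<beta>. T L (N \<alpha>) \<beta> \<subseteq> A \<alpha>} \<alpha>"
      proof (rule unbounded_in_mono[OF \<alpha>(4)])
        fix \<beta>
        assume "\<beta> \<in> S" "\<beta> < \<alpha>"
        then have "T L n \<beta> \<subseteq> C \<inter> {\<gamma><..}" "T L n \<beta> \<subseteq> {..<\<alpha>}"
          by (auto simp: S_def dest: T_le[OF L])
        then show "\<beta> \<in> {\<beta>. T L (N \<alpha>) \<beta> \<subseteq> A \<alpha>}"
          unfolding \<alpha>(5,6) by auto
      qed
      then have "T L n \<beta> \<subseteq> C" if "\<beta> \<in> ladder L \<alpha>" for \<beta>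
        using guided[OF \<alpha>(3) _ that] unfolding \<alpha>(5,6) by blast
      then have "T L (Suc n) \<alpha> \<subseteq> C"
        unfolding T_Suc_root using \<alpha>(2) by blast
      then show "{\<alpha>. T L (Suc n) \<alpha> \<subseteq> C} \<inter> D \<noteq> {}"
        using \<alpha>(1) by blast
    qed
  qed
  then show club_C_fin
    using L unfolding club_C_fin_def by blast
qed

end
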